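(* Let $\mathcal{P}$ denote the property ``the multigraph is simple'' and let $k\ge 3$ be fixed. Then: (1) if $p_n\ll \frac{1}{n^k}$, then $\lim_{n\to\infty} \mathbb{P}\left(\mathbb{G}(n,p_n\, ; \,\binom{[n]}{k})\in\mathcal{P}\right) = 1$; (2) if $p_n\gg \frac{1}{n^{k-1}}$, then $\lim_{n\to\infty} \mathbb{P}\left(\mathbb{G}(n,p_n\, ; \,\binom{[n]}{k})\in\mathcal{P}\right) = 0$.
   Context: $\binom{[n]}{k}$ denotes the collection of all $k$-element subsets of $[n]=\{1,\dots,n\}$. For $p\in[0,1]$, the random multigraph $\mathbb{G}(n,p\,;\,\binom{[n]}{k})$ is generated as follows: start with the empty graph on vertex set $[n]$; for every $H\in\binom{[n]}{k}$, choose a 2-element subset $\{i,j\}\subset H$ uniformly at random and then add an edge between $i$ and $j$ with probability $p$; all choices and coin flips are mutually independent. A multigraph is simple if no pair of vertices is joined by two or more edges. $a_n\ll b_n$ (equivalently $b_n\gg a_n$) means $a_n/b_n\to0$. *)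

theory Defs
  imports "HOL-Probability.Probability" "HOL-Probability.Product_PMF" "HOL-Library.Ramsey"
    "HOL-Library.Multiset"
begin

text \<open>
  A loopless undirected multigraph is a vertex set together with a multiset of edges, an edge
  being the two-element set of its endpoints.
\<close>

type_synonym 'a multigraph = "'a set \<times> 'a set multiset"

definition simple_multigraph :: "'a multigraph \<Rightarrow> bool" where
  "simple_multigraph G \<longleftrightarrow>
     (\<forall>u\<in>fst G. \<forall>v\<in>fst G. u \<noteq> v \<longrightarrow> count (snd G) {u, v} \<le> 1)"

text \<open>
  The contribution of a single member \<open>H\<close> of the family: a uniformly random pair inside \<open>H\<close>, kept
  with probability \<open>p\<close>. Here \<open>nsets H 2\<close> is the set of two-element subsets of \<open>H\<close>, which must be
  finite and nonempty.
\<close>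

definition edge_choice :: "real \<Rightarrow> 'a set \<Rightarrow> 'a set multiset pmf" where
  "edge_choice p H =
     do {
       e \<leftarrow> pmf_of_set (nsets H 2);
       b \<leftarrow> bernoulli_pmf p;
       return_pmf (if b then {#e#} else {#})
     }"

text \<open>
  The random multigraph on \<open>{1..n}\<close> driven by a finite family \<open>\<H>\<close> of subsets of \<open>{1..n}\<close>.
  The product distribution \<open>Pi_pmf\<close> makes the contributions of different members independent.
\<close>

definition random_multigraph :: "nat \<Rightarrow> real \<Rightarrow> nat set set \<Rightarrow> nat multigraph pmf" where
  "random_multigraph n p \<H> =
     map_pmf (\<lambda>f. ({1..n}, \<Sum>H\<in>\<H>. f H)) (Pi_pmf \<H> {#} (edge_choice p))"

text \<open>
  The first conjunct is needed because \<open>x / 0 = 0\<close>: without it, the zero sequence would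
  asymptotically dominate every sequence.
\<close>

definition much_less :: "(nat \<Rightarrow> real) \<Rightarrow> (nat \<Rightarrow> real) \<Rightarrow> bool" (infix "\<lless>" 50) where
  "a \<lless> b \<longleftrightarrow> (\<forall>\<^sub>F n in sequentially. b n \<noteq> 0) \<and> (\<lambda>n. a n / b n) \<longlonglongrightarrow> 0"

end

theory Submission
  imports Defs
begin

text \<open>
  Below the threshold, a union bound shows that typically there is no edge at all.

  Above it, one avoids a second moment argument by keeping only part of the family, chosen so that
  everything kept is independent. With \<open>m = n div 3\<close>, assign to a pair \<open>e\<close> inside \<open>{1..m}\<close> the
  \<open>N = m choose (k - 2)\<close> sets that extend \<open>e\<close> by points of \<open>{m+1..2m}\<close>, and the \<open>N\<close> sets that extend it
  by points of \<open>{2m+1..3m}\<close>. All these sets are distinct. If, for some \<open>e\<close>, both groups contain a set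
  contributing the edge \<open>e\<close>, then the multigraph is not simple. A set contributes \<open>e\<close> with probability
  \<open>q = p / (k choose 2)\<close>, so the multigraph is simple with probability at most
  \<open>(1 - (1 - (1 - q)^N)\<^sup>2)^M\<close>, where \<open>M = m choose 2\<close>. Bernoulli's inequality bounds this by
  \<open>(1 / (N q) + 1)\<^sup>2 / M\<close>, which is of order \<open>(1 / (n^(k-1) p) + 1 / n)\<^sup>2\<close>.
\<close>

section \<open>Independence under product distributions\<close>

lemma measure_pmf_prob_not:
  "measure_pmf.prob M {x. \<not> P x} = 1 - measure_pmf.prob M {x. P x}"
  using measure_pmf.prob_compl[of "{x. P x}" M] by (simp add: Compl_eq_Diff_UNIV[symmetric] Collect_neg_eq)

text \<open>Events that depend on disjoint sets of coordinates are independent. Split the product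
  into its factors over \<open>A\<close> and \<open>I - A\<close>: \<open>P\<close> reads only the
  first, \<open>Q\<close> only the second because \<open>B\<close> avoids \<open>A\<close>, so the
  joint event is a rectangle.\<close>

lemma prob_Pi_pmf_conj:
  assumes I: "finite I" and AB: "A \<subseteq> I" "A \<inter> B = {}"
    and P: "\<And>f g. (\<And>x. x \<in> A \<Longrightarrow> f x = g x) \<Longrightarrow> P f = P g"
    and Q: "\<And>f g. (\<And>x. x \<in> B \<Longrightarrow> f x = g x) \<Longrightarrow> Q f = Q g"
  shows "measure_pmf.prob (Pi_pmf I d D) {f. P f \<and> Q f} =
         measure_pmf.prob (Pi_pmf I d D) {f. P f} * measure_pmf.prob (Pi_pmf I d D) {f. Q f}"
proof -
  let ?L = "Pi_pmf A d D" and ?R = "Pi_pmf (I - A) d D"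
  define h where "h = (\<lambda>(f, g) x. if x \<in> A then f x else g x :: 'b)"
  have "Pi_pmf (A \<union> (I - A)) d D = map_pmf h (pair_pmf ?L ?R)"
    unfolding h_def using I AB by (intro Pi_pmf_union) (auto intro: finite_subset)
  then have eq: "Pi_pmf I d D = map_pmf h (pair_pmf ?L ?R)"
    using AB by (simp add: Un_absorb1)
  have hP: "P (h z) = P (fst z)" for z
    by (rule P) (auto simp: h_def split: prod.splits)
  have hQ: "Q (h z) = Q (snd z)" for z
    by (rule Q) (use AB in \<open>auto simp: h_def split: prod.splits\<close>)
  \<comment> \<open>Intersecting with the supports changes no probability and makes both sides
    countable, as \<open>measure_pmf_prob_product\<close> requires.\<close>
  have rect: "measure_pmf.prob (pair_pmf ?L ?R) (S \<times> T) = measure_pmf.prob ?L S * measure_pmf.prob ?R T" for S T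
  proof -
    have "measure_pmf.prob (pair_pmf ?L ?R) (S \<times> T) =
          measure_pmf.prob (pair_pmf ?L ?R) ((S \<inter> set_pmf ?L) \<times> (T \<inter> set_pmf ?R))"
      by (subst measure_Int_set_pmf [symmetric]) (simp add: Times_Int_Times)
    then show ?thesis
      by (simp add: measure_pmf_prob_product measure_Int_set_pmf)
  qed
  have "h -` {f. P f \<and> Q f} = {f. P f} \<times> {f. Q f}" "h -` {f. P f} = {f. P f} \<times> UNIV"
    "h -` {f. Q f} = UNIV \<times> {f. Q f}"
    by (auto simp: hP hQ)
  then show ?thesis
    by (simp add: eq rect)
qed

text \<open>Induction over \<open>E\<close>: the event of a new index \<open>e\<close> reads only
  the block \<open>F e\<close>, which is disjoint from the union of the earlier blocks, so one
  factor splits off.\<close>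

lemma prob_Pi_pmf_Ball:
  fixes P :: "'e \<Rightarrow> ('i \<Rightarrow> 'b) \<Rightarrow> bool"
  assumes I: "finite I" and "finite E" "disjoint_family_on F E" "\<And>e. e \<in> E \<Longrightarrow> F e \<subseteq> I"
    and P: "\<And>e f g. e \<in> E \<Longrightarrow> (\<And>x. x \<in> F e \<Longrightarrow> f x = g x) \<Longrightarrow> P e f = P e g"
  shows "measure_pmf.prob (Pi_pmf I d D) {f. \<forall>e\<in>E. P e f} =
         (\<Prod>e\<in>E. measure_pmf.prob (Pi_pmf I d D) {f. P e f})"
  using assms(2-)
proof (induction E rule: finite_induct)
  case empty
  then show ?case by simp
next
  case (insert e E)
  have disj: "F e \<inter> (\<Union>e'\<in>E. F e') = {}" "disjoint_family_on F E"
    using insert.prems(1) insert.hyps(2) by (auto simp: disjoint_family_on_def)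
  have "measure_pmf.prob (Pi_pmf I d D) {f. P e f \<and> (\<forall>e'\<in>E. P e' f)} =
    measure_pmf.prob (Pi_pmf I d D) {f. P e f} * measure_pmf.prob (Pi_pmf I d D) {f. \<forall>e'\<in>E. P e' f}"
  proof (rule prob_Pi_pmf_conj[OF I _ disj(1)])
    show "F e \<subseteq> I"
      by (rule insert.prems(2)) simp
    show "P e f = P e g" if "\<And>x. x \<in> F e \<Longrightarrow> f x = g x" for f g
      by (rule insert.prems(3)[OF insertI1 that])
    fix f g :: "'i \<Rightarrow> 'b" assume fg: "\<And>x. x \<in> (\<Union>e'\<in>E. F e') \<Longrightarrow> f x = g x"
    have "P e' f = P e' g" if "e' \<in> E" for e'
      by (rule insert.prems(3)) (use that fg in auto)
    then show "(\<forall>e'\<in>E. P e' f) = (\<forall>e'\<in>E. P e' g)"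
      by simp
  qed
  moreover have "measure_pmf.prob (Pi_pmf I d D) {f. \<forall>e'\<in>E. P e' f} =
      (\<Prod>e\<in>E. measure_pmf.prob (Pi_pmf I d D) {f. P e f})"
    by (intro insert.IH disj(2) insert.prems(2,3) insertI2)
  ultimately show ?case
    using insert.hyps by simp
qed

lemma prob_Pi_pmf_neq:
  assumes "finite I" "A \<subseteq> I"
  shows "measure_pmf.prob (Pi_pmf I d D) {f. \<forall>i\<in>A. f i \<noteq> x} = (\<Prod>i\<in>A. 1 - pmf (D i) x)"
proof -
  have "{f. \<forall>i\<in>A. f i \<noteq> x} = Pi I (\<lambda>i. if i \<in> A then - {x} else UNIV)"
    using assms(2) by (auto simp: Pi_def)
  then have "measure_pmf.prob (Pi_pmf I d D) {f. \<forall>i\<in>A. f i \<noteq> x} =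
      (\<Prod>i\<in>I. measure_pmf.prob (D i) (if i \<in> A then - {x} else UNIV))"
    by (simp add: measure_Pi_pmf_Pi assms(1))
  also have "\<dots> = (\<Prod>i\<in>I. if i \<in> A then 1 - pmf (D i) x else 1)"
    using measure_pmf.prob_compl[of "{x}" "D i" for i]
    by (intro prod.cong) (auto simp: measure_pmf_single Compl_eq_Diff_UNIV)
  also have "\<dots> = (\<Prod>i\<in>A. 1 - pmf (D i) x)"
    using assms by (simp add: prod.If_cases Int_absorb1)
  finally show ?thesis .
qed

section \<open>Contribution of one set, and the sparse regime\<close>

lemma pmf_edge_choice:
  assumes "finite H" "card H \<ge> 2" "0 \<le> p" "p \<le> 1"
  shows pmf_edge_choice_empty: "pmf (edge_choice p H) {#} = 1 - p"
    and pmf_edge_choice_single: "e \<in> nsets H 2 \<Longrightarrow> pmf (edge_choice p H) {#e#} = p / (card H choose 2)"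
proof -
  \<comment> \<open>\<open>card H \<ge> 2\<close> makes the uniform distribution on pairs of
    \<open>H\<close> meaningful.\<close>
  have ne: "nsets H 2 \<noteq> {}" and fin: "finite (nsets H 2)"
    using assms by (auto simp: nsets_eq_empty_iff finite_imp_finite_nsets)
  have card: "card (nsets H 2) = card H choose 2"
    using assms(1) by simp
  have inner: "pmf (bernoulli_pmf p \<bind> (\<lambda>b. return_pmf (if b then {#e'#} else {#}))) x =
      p * indicator {{#e'#}} x + (1 - p) * indicator {{#}} x" for e' and x :: "'a set multiset"
    using assms by (subst pmf_bind) (auto simp: indicator_def)
  show "pmf (edge_choice p H) {#} = 1 - p"
    unfolding edge_choice_def
    using ne fin assms by (subst pmf_bind_pmf_of_set) (auto simp: inner)
  show "pmf (edge_choice p H) {#e#} = p / (card H choose 2)" if "e \<in> nsets H 2"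
  proof -
    have "pmf (edge_choice p H) {#e#} = (\<Sum>e'\<in>nsets H 2. p * indicator {{#e'#}} {#e#}) / card (nsets H 2)"
      unfolding edge_choice_def
      using ne fin by (subst pmf_bind_pmf_of_set) (auto simp: inner)
    also have "(\<Sum>e'\<in>nsets H 2. p * indicator {{#e'#}} {#e#}) = (\<Sum>e'\<in>nsets H 2. if e' = e then p else 0)"
      by (intro sum.cong) (auto simp: indicator_def)
    finally show ?thesis
      using that fin by (simp add: card)
  qed
qed

text \<open>An edgeless multigraph is simple; by independence all contributions are empty with
  probability \<open>(1 - p) ^ card \<H>\<close>, and Bernoulli's inequality applies.\<close>

lemma prob_simple_ge:
  fixes p :: real
  assumes "finite \<H>" "\<And>H. H \<in> \<H> \<Longrightarrow> finite H \<and> card H \<ge> 2" "0 \<le> p" "p \<le> 1"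
  shows "measure_pmf.prob (random_multigraph n p \<H>) {G. simple_multigraph G} \<ge> 1 - card \<H> * p"
proof -
  have "1 - card \<H> * p \<le> (1 - p) ^ card \<H>"
    using Bernoulli_inequality[of "- p" "card \<H>"] assms by simp
  also have "\<dots> = (\<Prod>H\<in>\<H>. pmf (edge_choice p H) {#})"
    using assms by (simp add: pmf_edge_choice_empty)
  also have "\<dots> = measure_pmf.prob (Pi_pmf \<H> {#} (edge_choice p)) (Pi \<H> (\<lambda>_. {{#}}))"
    using assms by (simp add: measure_Pi_pmf_Pi measure_pmf_single)
  also have "\<dots> \<le> measure_pmf.prob (random_multigraph n p \<H>) {G. simple_multigraph G}"
    unfolding random_multigraph_def measure_map_pmf
    by (rule measure_pmf.finite_measure_mono) (auto simp: simple_multigraph_def Pi_def)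
  finally show ?thesis .
qed

section \<open>Repeated edges from disjoint groups of sets\<close>

lemma not_simple_multigraphI:
  assumes "finite \<H>" "H \<in> \<H>" "H' \<in> \<H>" "H \<noteq> H'" "e \<in> nsets V 2" "f H = {#e#}" "f H' = {#e#}"
  shows "\<not> simple_multigraph (V, \<Sum>H\<in>\<H>. f H)"
proof -
  obtain u v where uv: "e = {u, v}" "u \<in> V" "v \<in> V" "u \<noteq> v"
    using assms(5) by (auto simp: nsets_2_eq)
  have "2 = (\<Sum>H\<in>{H, H'}. count (f H) e)"
    using assms by simp
  also have "\<dots> \<le> (\<Sum>H\<in>\<H>. count (f H) e)"
    using assms by (intro sum_mono2) auto
  finally have "2 \<le> count (\<Sum>H\<in>\<H>. f H) e"
    by (simp add: count_sum)
  then have "\<not> count (\<Sum>H\<in>\<H>. f H) {u, v} \<le> 1"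
    using uv by simp
  with uv show ?thesis
    unfolding simple_multigraph_def by (metis fst_conv snd_conv)
qed

text \<open>Simplicity forces, for every \<open>e\<close>, that \<open>A e\<close> or
  \<open>B e\<close> contributes no copy of \<open>e\<close>. Collisions within a single group are
  ignored, so that each event is built from two independent ones; disjointness of the blocks
  \<open>A e \<union> B e\<close> then makes the events for different \<open>e\<close>
  independent.\<close>

lemma prob_simple_le:
  fixes A B :: "nat set \<Rightarrow> nat set set"
  assumes fin: "finite \<H>" and E: "E \<subseteq> nsets {1..n} 2" and p: "0 \<le> p" "p \<le> 1" and k: "k \<ge> 2"
    and \<H>: "\<And>H. H \<in> \<H> \<Longrightarrow> finite H \<and> card H = k"
    and A: "\<And>e. e \<in> E \<Longrightarrow> A e \<subseteq> \<H> \<and> card (A e) = N \<and> (\<forall>H\<in>A e. e \<subseteq> H)"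
    and B: "\<And>e. e \<in> E \<Longrightarrow> B e \<subseteq> \<H> \<and> card (B e) = N \<and> (\<forall>H\<in>B e. e \<subseteq> H)"
    and AB: "\<And>e. e \<in> E \<Longrightarrow> A e \<inter> B e = {}"
    and disj: "disjoint_family_on (\<lambda>e. A e \<union> B e) E"
  shows "measure_pmf.prob (random_multigraph n p \<H>) {G. simple_multigraph G}
         \<le> (1 - (1 - (1 - p / (k choose 2)) ^ N)\<^sup>2) ^ card E"
proof -
  let ?M = "Pi_pmf \<H> {#} (edge_choice p)"
  let ?miss = "\<lambda>S e f. \<forall>H\<in>S. f H \<noteq> {#e#}"
  have miss: "measure_pmf.prob ?M {f. ?miss S e f} = (1 - p / (k choose 2)) ^ N"
    if "e \<in> E" "S \<subseteq> \<H>" "card S = N" "\<forall>H\<in>S. e \<subseteq> H" for S e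
  proof -
    have "e \<in> nsets H 2" if "H \<in> S" for H
      using that \<open>e \<in> E\<close> E \<open>\<forall>H\<in>S. e \<subseteq> H\<close> by (auto simp: nsets_def)
    then have "(\<Prod>H\<in>S. 1 - pmf (edge_choice p H) {#e#}) = (\<Prod>H\<in>S. 1 - p / (k choose 2))"
      using \<H> \<open>S \<subseteq> \<H>\<close> p k by (intro prod.cong) (auto simp: pmf_edge_choice_single subset_iff)
    then show ?thesis
      using that fin by (simp add: prob_Pi_pmf_neq)
  qed
  have hit: "measure_pmf.prob ?M {f. \<not> ?miss S e f} = 1 - (1 - p / (k choose 2)) ^ N"
    if "e \<in> E" "S \<subseteq> \<H>" "card S = N" "\<forall>H\<in>S. e \<subseteq> H" for S e
    by (simp only: measure_pmf_prob_not miss[OF that])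
  have pair: "measure_pmf.prob ?M {f. ?miss (A e) e f \<or> ?miss (B e) e f} =
      1 - (1 - (1 - p / (k choose 2)) ^ N)\<^sup>2" if e: "e \<in> E" for e
  proof -
    have "measure_pmf.prob ?M {f. \<not> ?miss (A e) e f \<and> \<not> ?miss (B e) e f} =
        measure_pmf.prob ?M {f. \<not> ?miss (A e) e f} * measure_pmf.prob ?M {f. \<not> ?miss (B e) e f}"
      using A[OF e] AB[OF e] by (intro prob_Pi_pmf_conj[OF fin, of "A e" "B e"]) auto
    also have "\<dots> = (1 - (1 - p / (k choose 2)) ^ N)\<^sup>2"
      using A[OF e] B[OF e] hit[OF e] by (simp add: power2_eq_square)
    finally show ?thesis
      using measure_pmf_prob_not[of ?M "\<lambda>f. \<not> ?miss (A e) e f \<and> \<not> ?miss (B e) e f"]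
      by (simp only: de_Morgan_conj not_not)
  qed
  have "measure_pmf.prob (random_multigraph n p \<H>) {G. simple_multigraph G}
      \<le> measure_pmf.prob ?M {f. \<forall>e\<in>E. ?miss (A e) e f \<or> ?miss (B e) e f}"
    unfolding random_multigraph_def measure_map_pmf
  proof (rule measure_pmf.finite_measure_mono)
    show "(\<lambda>f. ({1..n}, \<Sum>H\<in>\<H>. f H)) -` {G. simple_multigraph G}
        \<subseteq> {f. \<forall>e\<in>E. ?miss (A e) e f \<or> ?miss (B e) e f}"
    proof clarsimp
      fix f e H H'
      assume "simple_multigraph ({Suc 0..n}, sum f \<H>)" "e \<in> E"
        "H \<in> A e" "H' \<in> B e" "f H = {#e#}" "f H' = {#e#}"
      then show False
        using not_simple_multigraphI[OF fin, of H H' e "{1..n}" f] A B AB E by fastforce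
    qed
  qed simp
  also have "\<dots> = (\<Prod>e\<in>E. measure_pmf.prob ?M {f. ?miss (A e) e f \<or> ?miss (B e) e f})"
  proof (rule prob_Pi_pmf_Ball[OF fin _ disj])
    show "finite E"
      using E by (rule finite_subset) (simp add: finite_imp_finite_nsets)
  qed (use A B in auto)
  also have "\<dots> = (1 - (1 - (1 - p / (k choose 2)) ^ N)\<^sup>2) ^ card E"
    by (simp add: pair)
  finally show ?thesis .
qed

section \<open>Numerical estimates\<close>

text \<open>Bernoulli gives \<open>1 + m * x \<le> (1 + x) ^ m\<close>, and
  \<open>(1 - x) * (1 + x) \<le> 1\<close>.\<close>

lemma power_one_minus_le_inverse:
  fixes x :: real
  assumes "0 \<le> x" "x \<le> 1"
  shows "(1 - x) ^ m \<le> 1 / (1 + m * x)"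
proof -
  have "(1 - x) ^ m * (1 + m * x) \<le> (1 - x) ^ m * (1 + x) ^ m"
    using assms Bernoulli_inequality[of x m] by (intro mult_left_mono) auto
  also have "\<dots> = (1 - x * x) ^ m"
    by (simp add: power_mult_distrib[symmetric] algebra_simps)
  also have "\<dots> \<le> 1"
    using assms by (intro power_le_one) (auto intro: mult_le_one)
  finally show ?thesis
    using assms by (simp add: field_simps add_pos_nonneg)
qed

text \<open>The previous estimate is used twice: inside, it bounds the hitting probability
  \<open>r\<close> of one group below by \<open>t / (1 + t)\<close> with \<open>t = N * q\<close>;
  outside, it bounds \<open>(1 - r^2) ^ M\<close>. The result is rational in \<open>q\<close>, so
  large and small \<open>N * q\<close> need no separate treatment.\<close>

lemma collision_bound:
  fixes q :: real
  assumes "0 < q" "q \<le> 1" "N > 0" "M > 0"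
  shows "(1 - (1 - (1 - q) ^ N)\<^sup>2) ^ M \<le> (1 / (N * q) + 1)\<^sup>2 / M"
proof -
  define r where "r = 1 - (1 - q) ^ N"
  define t where "t = N * q"
  have t: "t > 0" using assms by (simp add: t_def)
  have "t / (1 + t) = 1 - 1 / (1 + t)"
    using t by (simp add: field_simps)
  also have "\<dots> \<le> r"
    unfolding r_def t_def using power_one_minus_le_inverse[of q N] assms by simp
  finally have "t / (1 + t) \<le> r" .
  then have sq: "(t / (1 + t))\<^sup>2 \<le> r\<^sup>2" 
    using t by (intro power_mono) auto
  have "0 \<le> r" "r \<le> 1"
    unfolding r_def using assms by (auto intro: power_le_one)
  then have "(1 - r\<^sup>2) ^ M \<le> 1 / (1 + M * r\<^sup>2)"
    by (intro power_one_minus_le_inverse) (auto intro: power_le_one)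
  also have "\<dots> \<le> 1 / (M * (t / (1 + t))\<^sup>2)"
    using t assms sq by (intro divide_left_mono mult_pos_pos add_pos_nonneg) (auto intro!: add_increasing mult_left_mono)
  also have "\<dots> = (1 / t + 1)\<^sup>2 / M"
    using t assms by (simp add: field_simps power2_eq_square)
  finally show ?thesis
    by (simp add: r_def t_def)
qed

section \<open>The groups inside the family of all k-subsets\<close>

lemma prob_simple_nsets_le:
  fixes p :: real
  assumes k: "k \<ge> 3" and m: "3 * m \<le> n" and p: "0 \<le> p" "p \<le> 1"
  shows "measure_pmf.prob (random_multigraph n p (nsets {1..n} k)) {G. simple_multigraph G}
         \<le> (1 - (1 - (1 - p / (k choose 2)) ^ (m choose (k - 2)))\<^sup>2) ^ (m choose 2)"
proof -
  define X where "X U e = (\<lambda>R. e \<union> R) ` nsets U (k - 2)" for U e :: "nat set"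
  let ?E = "nsets {1..m} 2"
  have X: "X U e \<subseteq> nsets {1..n} k \<and> card (X U e) = m choose (k - 2) \<and> (\<forall>H\<in>X U e. e \<subseteq> H)"
    if e: "e \<in> ?E" and U: "U \<subseteq> {m+1..n}" "card U = m" for U e
  proof (intro conjI)
    have disj: "e \<inter> R = {}" if "R \<subseteq> U" for R
      using e U that by (force simp: nsets_def)
    have "e \<union> R \<in> nsets {1..n} k" if "R \<in> nsets U (k - 2)" for R
    proof -
      have "card (e \<union> R) = k"
        using that e disj[of R] k by (subst card_Un_disjoint) (auto simp: nsets_def)
      moreover have "e \<subseteq> {1..n}"
        using e m by (force simp: nsets_def)
      moreover have "R \<subseteq> {1..n}"
        using that U by (force simp: nsets_def)
      ultimately show ?thesis
        using that e by (auto simp: nsets_def)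
    qed
    then show "X U e \<subseteq> nsets {1..n} k"
      by (auto simp: X_def)
    have "inj_on (\<lambda>R. e \<union> R) (nsets U (k - 2))"
    proof (rule inj_onI)
      fix R S assume "R \<in> nsets U (k - 2)" "S \<in> nsets U (k - 2)" "e \<union> R = e \<union> S"
      then show "R = S"
        using disj[of R] disj[of S] by (auto simp: nsets_def)
    qed
    then show "card (X U e) = m choose (k - 2)"
      using U by (simp add: X_def card_image)
    show "\<forall>H\<in>X U e. e \<subseteq> H"
      by (auto simp: X_def)
  qed
  let ?U = "{m+1..2*m}" and ?V = "{2*m+1..3*m}"
  have U: "?U \<subseteq> {m+1..n}" "card ?U = m" and V: "?V \<subseteq> {m+1..n}" "card ?V = m"
    using m by auto
  \<comment> \<open>A set in either group determines its pair as its trace on \<open>{1..m}\<close>;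
    hence blocks of different pairs are disjoint.\<close>
  have trace: "H \<inter> {1..m} = e" if "e \<in> ?E" "H \<in> X ?U e \<union> X ?V e" for e H
    using that by (force simp: X_def nsets_def)
  have UV_disj: "X ?U e \<inter> X ?V e = {}" if e: "e \<in> ?E" for e
  proof (rule ccontr)
    assume "X ?U e \<inter> X ?V e \<noteq> {}"
    then obtain R S where RS: "R \<in> nsets ?U (k - 2)" "S \<in> nsets ?V (k - 2)" "e \<union> R = e \<union> S"
      by (auto simp: X_def)
    \<comment> \<open>Here \<open>k \<ge> 3\<close> matters: a point of \<open>R\<close> lies in
      \<open>?U\<close>, hence neither in \<open>e\<close> nor in \<open>S\<close>. For
      \<open>k = 2\<close> both groups would be \<open>{e}\<close>.\<close>
    then have "R \<noteq> {}"
      using k by (auto simp: nsets_def)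
    then obtain x where "x \<in> R"
      by auto
    moreover from this have "x \<in> e \<union> S"
      using RS by auto
    ultimately show False
      using RS e by (force simp: nsets_def)
  qed
  have disj: "disjoint_family_on (\<lambda>e. X ?U e \<union> X ?V e) ?E"
    unfolding disjoint_family_on_def
  proof (intro ballI impI)
    fix e e' assume "e \<in> ?E" "e' \<in> ?E" "e \<noteq> e'"
    then show "(X ?U e \<union> X ?V e) \<inter> (X ?U e' \<union> X ?V e') = {}"
      using trace by blast
  qed
  have "measure_pmf.prob (random_multigraph n p (nsets {1..n} k)) {G. simple_multigraph G}
         \<le> (1 - (1 - (1 - p / (k choose 2)) ^ (m choose (k - 2)))\<^sup>2) ^ card ?E"
  proof (rule prob_simple_le[where A = "X ?U" and B = "X ?V"])
    show "?E \<subseteq> nsets {1..n} 2"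
      using m by (intro nsets_mono) auto
    show "finite H \<and> card H = k" if "H \<in> nsets {1..n} k" for H
      using that by (auto simp: nsets_def)
    show "finite (nsets {1..n} k)"
      by (simp add: finite_imp_finite_nsets)
    show "2 \<le> k"
      using k by simp
  qed (fact p X[OF _ U] X[OF _ V] UV_disj disj)+
  then show ?thesis
    by simp
qed

text \<open>Combines the two preceding bounds with \<open>(m / j) ^ j \<le> m choose j\<close>.
  Since \<open>n \<le> 6 * m\<close>, this yields the constant \<open>6 * (k - 2)\<close> from
  \<open>j = k - 2\<close> and 12 from \<open>j = 2\<close>.\<close>

lemma prob_simple_nsets_le_inverse:
  fixes p :: real
  assumes k: "k \<ge> 3" and n: "n \<ge> 6 * k" and p: "0 < p" "p \<le> 1"
  shows "measure_pmf.prob (random_multigraph n p (nsets {1..n} k)) {G. simple_multigraph G}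
         \<le> (12 * ((k choose 2) * (6 * (k - 2)) ^ (k - 2) * (1 / real n ^ (k - 1) / p) + 1 / n))\<^sup>2"
proof -
  define m where "m = n div 3"
  define j where "j = k - 2"
  define K where "K = real (k choose 2)"
  have m: "3 * m \<le> n" "n \<le> 6 * m" "k \<le> m"
    using n k by (auto simp: m_def)
  have j: "j > 0" "j \<le> m" "k - 1 = Suc j"
    using k m by (auto simp: j_def)
  have n0: "n > 0"
    using n k by simp
  have K: "K \<ge> 1"
    using k by (simp add: K_def Suc_le_eq zero_less_binomial)
  have q: "0 < p / K" "p / K \<le> 1"
    using p K by (auto simp: divide_le_eq)
  have N: "(real n / (6 * j)) ^ j \<le> m choose j"
  proof -
    have "(real n / (6 * j)) ^ j \<le> (real m / j) ^ j"
      using m j by (intro power_mono) (auto simp: field_simps)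
    also have "\<dots> \<le> m choose j"
      using j binomial_ge_n_over_k_pow_k[of j m, where 'a = real] by simp
    finally show ?thesis .
  qed
  have M: "(real n / 12)\<^sup>2 \<le> m choose 2"
  proof -
    have "(real n / 12)\<^sup>2 \<le> (real m / 2)\<^sup>2"
      using m by (intro power_mono) auto
    also have "\<dots> \<le> m choose 2"
      using k m binomial_ge_n_over_k_pow_k[of 2 m, where 'a = real] by simp
    finally show ?thesis .
  qed
  define a b where "a = real n ^ j" and "b = real ((6 * j) ^ j)"
  have ab: "a > 0" "b > 0"
    using n0 j by (simp_all add: a_def b_def)
  have N': "a / b \<le> m choose j"
    using N by (simp add: a_def b_def power_divide)
  have "measure_pmf.prob (random_multigraph n p (nsets {1..n} k)) {G. simple_multigraph G}
      \<le> (1 - (1 - (1 - p / K) ^ (m choose j))\<^sup>2) ^ (m choose 2)"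
    unfolding K_def j_def using k m p by (intro prob_simple_nsets_le) auto
  also have "\<dots> \<le> (1 / ((m choose j) * (p / K)) + 1)\<^sup>2 / (m choose 2)"
    using q j k m by (intro collision_bound) (auto simp: zero_less_binomial)
  also have "\<dots> \<le> (1 / ((a / b) * (p / K)) + 1)\<^sup>2 / (real n / 12)\<^sup>2"
  proof (rule frac_le)
    have "1 / ((m choose j) * (p / K)) \<le> 1 / ((a / b) * (p / K))"
      using N' ab q(1) less_le_trans[OF divide_pos_pos[OF ab] N']
      by (intro divide_left_mono mult_right_mono mult_pos_pos) simp_all
    moreover have "0 \<le> 1 / ((m choose j) * (p / K))"
      using p K by simp
    ultimately show "(1 / ((m choose j) * (p / K)) + 1)\<^sup>2 \<le> (1 / ((a / b) * (p / K)) + 1)\<^sup>2"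
      by (intro power_mono) simp_all
  qed (use M n0 in simp_all)
  also have "\<dots> = ((1 / ((a / b) * (p / K)) + 1) / (real n / 12))\<^sup>2"
    by (simp only: power_divide)
  \<comment> \<open>The square root of the number of pairs supplies a factor of order
    \<open>n\<close>, which raises \<open>a = n^(k-2)\<close> to the threshold power
    \<open>n^(k-1)\<close>.\<close>
  also have "(1 / ((a / b) * (p / K)) + 1) / (real n / 12) = 12 * (K * b * (1 / (real n * a) / p) + 1 / n)"
    using ab p K n0 by (simp add: divide_simps)
  finally show ?thesis
    by (simp add: K_def a_def b_def j_def[symmetric] j(3)[simplified])
qed

section \<open>The two limits\<close>

theorem theorem1p7:
  fixes k :: nat and p :: "nat \<Rightarrow> real"
  assumes "k \<ge> 3"
    and "\<And>n. 0 \<le> p n \<and> p n \<le> 1"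
  shows "(p \<lless> (\<lambda>n. 1 / real n ^ k) \<longrightarrow>
            (\<lambda>n. measure_pmf.prob (random_multigraph n (p n) (nsets {1..n} k))
                   {G. simple_multigraph G}) \<longlonglongrightarrow> 1) \<and>
         ((\<lambda>n. 1 / real n ^ (k - 1)) \<lless> p \<longrightarrow>
            (\<lambda>n. measure_pmf.prob (random_multigraph n (p n) (nsets {1..n} k))
                   {G. simple_multigraph G}) \<longlonglongrightarrow> 0)"
proof (intro conjI impI)
  let ?P = "\<lambda>n. measure_pmf.prob (random_multigraph n (p n) (nsets {1..n} k)) {G. simple_multigraph G}"
  show "?P \<longlonglongrightarrow> 1" if "p \<lless> (\<lambda>n. 1 / real n ^ k)"
  proof (rule tendsto_sandwich)
    from that have "(\<lambda>n. p n * real n ^ k) \<longlonglongrightarrow> 0"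
      by (simp add: much_less_def)
    then show "(\<lambda>n. 1 - p n * real n ^ k) \<longlonglongrightarrow> 1"
      by (auto intro: tendsto_eq_intros)
    have "1 - p n * real n ^ k \<le> ?P n" for n
    proof -
      have "n choose k \<le> n ^ k"
        \<comment> \<open>For \<open>n < k\<close> the binomial coefficient vanishes, so the bound
          holds for every \<open>n\<close>.\<close>
        by (cases "k \<le> n") (auto intro: binomial_le_pow simp: binomial_eq_0)
      then have "(n choose k) * p n \<le> real n ^ k * p n"
        using assms(2)[of n] by (intro mult_right_mono) (simp_all flip: of_nat_power)
      moreover have "1 - card (nsets {1..n} k) * p n \<le> ?P n"
        using assms by (intro prob_simple_ge) (auto simp: finite_imp_finite_nsets nsets_def)
      ultimately show ?thesis
        by (simp add: mult.commute)
    qed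
    then show "\<forall>\<^sub>F n in sequentially. 1 - p n * real n ^ k \<le> ?P n"
      by simp
  qed auto
  show "?P \<longlonglongrightarrow> 0" if less: "(\<lambda>n. 1 / real n ^ (k - 1)) \<lless> p"
  proof (rule tendsto_sandwich[of "\<lambda>_. 0"])
    let ?b = "\<lambda>n. (12 * ((k choose 2) * (6 * (k - 2)) ^ (k - 2) *
      (1 / real n ^ (k - 1) / p n) + 1 / n))\<^sup>2"
    have lim: "(\<lambda>n. 1 / real n ^ (k - 1) / p n) \<longlonglongrightarrow> 0" and ne: "\<forall>\<^sub>F n in sequentially. p n \<noteq> 0"
      using less by (auto simp: much_less_def)
    have "?b \<longlonglongrightarrow> (12 * (real ((k choose 2) * (6 * (k - 2)) ^ (k - 2)) * 0 + 0))\<^sup>2"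
      by (intro tendsto_intros lim lim_1_over_n)
    then show "?b \<longlonglongrightarrow> 0"
      by simp
    show "\<forall>\<^sub>F n in sequentially. ?P n \<le> ?b n"
      \<comment> \<open>The nonvanishing condition in \<open>\<lless>\<close> gives
        \<open>p n > 0\<close> eventually; where \<open>p n = 0\<close> the multigraph is surely
        simple and the division by \<open>p n\<close> would be void.\<close>
      using ne eventually_ge_at_top[of "6 * k"]
    proof eventually_elim
      case (elim n)
      with assms(2)[of n] show ?case
        by (intro prob_simple_nsets_le_inverse assms(1)) auto
    qed
  qed auto
qed

end
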